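(* Let $f(x)\in\mathbb{Z}[x]$ be a polynomial of degree two such that $S_\infty(f)$ is specializable. Then \[ f(x)\in\{-x^2-2x-2,\ -x^2-2x-1,\ x^2,\ x^2-1\}. \]
   Context: For $f(x)\in\mathbb{Z}[x]$ set $f_0(x)=x$ and $f_{n+1}(x)=f(f_n(x))$. $S_\infty(f)$ denotes the regular continued fraction expansion of $\prod_{i=0}^{\infty}(1+1/f_i(x))$ viewed as an element of the field $\mathbb{Q}((1/x))$ of formal Laurent series in $1/x$ (partial quotients are polynomials in $\mathbb{Q}[x]$). It is called specializable if all of its partial quotients lie in $\mathbb{Z}[x]$. *)

theory Defs
  imports
    "HOL-Analysis.Infinite_Products"
    "HOL-Computational_Algebra.Computational_Algebra"
begin

text \<open>
  The field \<open>K((1/x))\<close> is the type \<^typ>\<open>'a fls\<close> with the formal variable read as \<open>1/x\<close>: thus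
  \<^const>\<open>fls_X\<close> stands for \<open>1/x\<close>, \<^const>\<open>fls_X_inv\<close> for \<open>x\<close>, and the coefficient of \<open>x ^ n\<close> in
  \<open>\<alpha>\<close> is \<open>fls_nth \<alpha> (- int n)\<close>. The library topology on \<^typ>\<open>'a fls\<close> is the \<open>1/x\<close>-adic one.
\<close>

definition poly_to_fls :: "'a::field poly \<Rightarrow> 'a fls" where
  "poly_to_fls p = poly (map_poly fls_const p) fls_X_inv"

text \<open>
  The polynomial part, in \<open>x\<close>, of an element of \<open>K((1/x))\<close>. The polynomial \<^term>\<open>fls_prpart \<alpha>\<close>
  omits the constant term.
\<close>

definition poly_part :: "'a::field fls \<Rightarrow> 'a poly" where
  "poly_part \<alpha> = fls_prpart \<alpha> + [:fls_nth \<alpha> 0:]"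

text \<open>
  The expansion is finite if some complete quotient is a polynomial; every later index then
  yields \<^const>\<open>None\<close>.
\<close>

primrec complete_quotient :: "'a::field fls \<Rightarrow> nat \<Rightarrow> 'a fls option" where
  "complete_quotient \<alpha> 0 = Some \<alpha>"
| "complete_quotient \<alpha> (Suc n) =
     (case complete_quotient \<alpha> n of
        None \<Rightarrow> None
      | Some \<beta> \<Rightarrow>
          if \<beta> = poly_to_fls (poly_part \<beta>) then None
          else Some (inverse (\<beta> - poly_to_fls (poly_part \<beta>))))"

definition partial_quotient :: "'a::field fls \<Rightarrow> nat \<Rightarrow> 'a poly option" where
  "partial_quotient \<alpha> n = map_option poly_part (complete_quotient \<alpha> n)"

definition poly_iterate :: "int poly \<Rightarrow> nat \<Rightarrow> int poly" where
  "poly_iterate f n = ((\<lambda>g. pcompose f g) ^^ n) [:0, 1:]"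

definition iterate_product :: "int poly \<Rightarrow> rat fls" where
  "iterate_product f = (\<Prod>i. 1 + 1 / poly_to_fls (map_poly of_int (poly_iterate f i)))"

definition S_inf :: "int poly \<Rightarrow> nat \<Rightarrow> rat poly option" where
  "S_inf f = partial_quotient (iterate_product f)"

definition specializable :: "(nat \<Rightarrow> rat poly option) \<Rightarrow> bool" where
  "specializable S \<longleftrightarrow> (\<forall>n a. S n = Some a \<longrightarrow> a \<in> range (map_poly rat_of_int))"

end

theory Submission
  imports Defs
begin

text \<open>
  If the expansion is specializable, then \<open>f\<close> has leading coefficient \<open>\<plusminus>1\<close> (the first nonconstant
  partial quotient is \<open>x - 1 / a\<close>, where \<open>a\<close> is the leading coefficient of \<open>f\<close>), so the product \<open>\<alpha>\<close>
  has integer coefficients, and it follows inductively that every complete quotient has integer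
  coefficients and leading coefficient \<open>\<plusminus>1\<close>. By the best approximation property, whenever \<open>p\<close>, \<open>q\<close>
  are integer polynomials with \<open>deg (q \<alpha> - p) < - deg q\<close>, the leading coefficients of \<open>q\<close> and
  \<open>q \<alpha> - p\<close> agree up to sign. Replacing \<open>\<alpha>\<close> by a partial product \<open>N / D\<close>, this becomes a condition
  on the polynomial \<open>q N - p D\<close>, and suitable choices of \<open>p\<close>, \<open>q\<close> (convergents of \<open>\<alpha>\<close>) exclude all
  monic \<open>f\<close> but \<open>x\<^sup>2\<close> and \<open>x\<^sup>2 - 1\<close>. Passing from \<open>f(x)\<close> to \<open>- 1 - f(- 1 - x)\<close> interchanges \<open>N\<close> and \<open>D\<close>
  up to the substitution \<open>x \<mapsto> - 1 - x\<close> and a sign, which settles leading coefficient \<open>- 1\<close>.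
\<close>

unbundle Formal_Laurent_Series.fps_syntax

subsection \<open>Polynomials as Laurent series\<close>

lemma poly_to_fls_0 [simp]: "poly_to_fls 0 = 0"
  by (simp add: poly_to_fls_def)

lemma poly_to_fls_pCons: "poly_to_fls (pCons a p) = fls_const a + fls_X_inv * poly_to_fls p"
  by (simp add: poly_to_fls_def map_poly_pCons)

lemma poly_to_fls_1 [simp]: "poly_to_fls 1 = 1"
  by (simp add: one_pCons poly_to_fls_pCons)

lemma poly_to_fls_nth: "poly_to_fls p $$ k = (if k \<le> 0 then coeff p (nat (- k)) else 0)"
proof (induction p arbitrary: k)
  case (pCons a p)
  show ?case
  proof (cases "k < 0")
    case True
    then have "nat (- k) = Suc (nat (- (k + 1)))"
      by simp
    with True show ?thesis
      by (simp add: poly_to_fls_pCons fls_X_inv_times_conv_shift pCons.IH)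
  next
    case False
    then show ?thesis
      by (auto simp: poly_to_fls_pCons fls_X_inv_times_conv_shift pCons.IH)
  qed
qed simp

lemma poly_to_fls_add: "poly_to_fls (p + q) = poly_to_fls p + poly_to_fls q"
  by (rule fls_eqI) (simp add: poly_to_fls_nth)

lemma poly_to_fls_diff: "poly_to_fls (p - q) = poly_to_fls p - poly_to_fls q"
  by (rule fls_eqI) (simp add: poly_to_fls_nth)

lemma poly_to_fls_smult: "poly_to_fls (smult a p) = fls_const a * poly_to_fls p"
  by (rule fls_eqI) (simp add: poly_to_fls_nth)

lemma poly_to_fls_mult: "poly_to_fls (p * q) = poly_to_fls p * poly_to_fls q"
  by (induction p)
    (simp_all add: poly_to_fls_pCons poly_to_fls_add poly_to_fls_smult algebra_simps)

lemma fls_subdegree_poly_to_fls [simp]: "fls_subdegree (poly_to_fls p) = - int (degree p)"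
proof (cases "p = 0")
  case False
  then show ?thesis
    by (intro fls_subdegree_eqI) (auto simp: poly_to_fls_nth intro!: coeff_eq_0)
qed simp

lemma poly_to_fls_eq_0_iff [simp]: "poly_to_fls p = 0 \<longleftrightarrow> p = 0"
proof
  assume "poly_to_fls p = 0"
  then have "poly_to_fls p $$ (- int (degree p)) = 0"
    by simp
  then show "p = 0"
    by (simp add: poly_to_fls_nth)
qed simp

lemma coeff_poly_part [simp]: "coeff (poly_part \<alpha>) n = \<alpha> $$ (- int n)"
  by (cases n) (simp_all add: poly_part_def)

lemma fls_minus_poly_part_nth:
  "(\<alpha> - poly_to_fls (poly_part \<alpha>)) $$ k = (if k \<le> 0 then 0 else \<alpha> $$ k)"
  by (simp add: poly_to_fls_nth)

lemma fls_subdegree_minus_poly_part: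
  assumes "\<alpha> \<noteq> poly_to_fls (poly_part \<alpha>)"
  shows "fls_subdegree (\<alpha> - poly_to_fls (poly_part \<alpha>)) > 0"
  using assms fls_minus_poly_part_nth[of \<alpha>] by (intro fls_subdegree_greaterI) auto

subsection \<open>Leading coefficients\<close>

text \<open>Orders are taken in 1/x, so the lowest term of the series is the one with the highest
  power of x: minus \<open>fls_subdegree\<close> acts as the degree and \<open>fls_lead\<close>
  extends \<open>lead_coeff\<close>.\<close>

definition fls_lead :: "'a::zero fls \<Rightarrow> 'a" where
  "fls_lead \<alpha> = \<alpha> $$ fls_subdegree \<alpha>"

lemma fls_lead_eq_0_iff [simp]: "fls_lead \<alpha> = 0 \<longleftrightarrow> \<alpha> = 0"
  by (auto simp: fls_lead_def intro: ccontr dest: nth_fls_subdegree_nonzero)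

lemma fls_lead_mult:
  fixes \<alpha> \<beta> :: "'a::semiring_no_zero_divisors fls"
  shows "fls_lead (\<alpha> * \<beta>) = fls_lead \<alpha> * fls_lead \<beta>"
  by (cases "\<alpha> = 0 \<or> \<beta> = 0") (auto simp: fls_lead_def)

lemma fls_lead_inverse: "fls_lead (inverse \<alpha>) = inverse (fls_lead (\<alpha> :: 'a::field fls))"
  unfolding fls_lead_def by (rule fls_inverse_subdegree_base)

lemma fls_lead_divide: "fls_lead (\<alpha> / \<beta>) = fls_lead \<alpha> / fls_lead (\<beta> :: 'a::field fls)"
  by (simp add: divide_inverse fls_lead_mult fls_lead_inverse)

lemma fls_lead_uminus: "fls_lead (- \<alpha>) = - fls_lead (\<alpha> :: 'a::group_add fls)"
  by (simp add: fls_lead_def)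

lemma fls_lead_poly_to_fls [simp]: "fls_lead (poly_to_fls p) = lead_coeff p"
  by (simp add: fls_lead_def poly_to_fls_nth)

text \<open>The case \<open>\<beta> = 0\<close> is listed separately because
  \<open>fls_subdegree 0 = 0\<close> by convention, although zero should have infinite
  order.\<close>

lemma fls_lead_add:
  fixes \<alpha> \<beta> :: "'a::monoid_add fls"
  assumes "\<alpha> \<noteq> 0" "\<beta> = 0 \<or> fls_subdegree \<alpha> < fls_subdegree \<beta>"
  shows "fls_lead (\<alpha> + \<beta>) = fls_lead \<alpha>" "fls_subdegree (\<alpha> + \<beta>) = fls_subdegree \<alpha>"
proof -
  show sub: "fls_subdegree (\<alpha> + \<beta>) = fls_subdegree \<alpha>"
    using assms fls_subdegree_add_eq1[of \<alpha> \<beta>] by auto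
  show "fls_lead (\<alpha> + \<beta>) = fls_lead \<alpha>"
    using assms by (auto simp: fls_lead_def sub)
qed

subsection \<open>Best approximation\<close>

text \<open>\<open>complete_quotient\<close> recurses at the far end of the expansion; the descent
  below needs to peel off the first step instead.\<close>

lemma complete_quotient_step:
  assumes "complete_quotient \<alpha> 1 = Some \<beta>"
  shows "complete_quotient \<alpha> (Suc n) = complete_quotient \<beta> n"
proof (induction n)
  case (Suc n)
  show ?case
    by (simp only: complete_quotient.simps(2)[of \<alpha> "Suc n"] complete_quotient.simps(2)[of \<beta> n] Suc)
qed (use assms in simp)

text \<open>
  One step of the continued fraction algorithm turns an approximation \<open>p / q\<close> of \<open>\<alpha>\<close> into the
  approximation \<open>q / (p - a q)\<close> of the next complete quotient, \<open>a\<close> being the polynomial part of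
  \<open>\<alpha>\<close>. This is the descent on the degree of \<open>q\<close>.
\<close>

lemma best_approximation_lead:
  fixes \<alpha> :: "'a::linordered_field fls"
  assumes "\<And>n \<beta>. complete_quotient \<alpha> (Suc n) = Some \<beta> \<Longrightarrow> \<bar>fls_lead \<beta>\<bar> = 1"
    and "q \<noteq> 0"
    and "poly_to_fls q * \<alpha> \<noteq> poly_to_fls p"
    and "fls_subdegree (poly_to_fls q * \<alpha> - poly_to_fls p) > int (degree q)"
  shows "\<bar>fls_lead (poly_to_fls q * \<alpha> - poly_to_fls p)\<bar> = \<bar>lead_coeff q\<bar>"
  using assms
proof (induction "degree q" arbitrary: \<alpha> p q rule: less_induct)
  case less
  define a where "a = poly_part \<alpha>"
  define \<rho> where "\<rho> = \<alpha> - poly_to_fls a"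
  define \<beta> where "\<beta> = inverse \<rho>"
  define p' where "p' = p - q * a"
  let ?\<delta> = "poly_to_fls q * \<alpha> - poly_to_fls p"
  have \<delta>: "?\<delta> = poly_to_fls q * \<rho> - poly_to_fls p'"
    by (simp add: \<rho>_def p'_def poly_to_fls_diff poly_to_fls_mult algebra_simps)
  have \<delta>0: "?\<delta> \<noteq> 0"
    using less.prems(3) by simp
  have \<rho>0: "\<rho> \<noteq> 0"
  proof
    assume "\<rho> = 0"
    then have "?\<delta> = poly_to_fls (- p')"
      by (simp add: \<delta> poly_to_fls_diff[of 0, simplified])
    then have "fls_subdegree ?\<delta> \<le> 0"
      by simp
    with less.prems(4) show False
      by simp
  qed
  have cq1: "complete_quotient \<alpha> 1 = Some \<beta>"
    using \<rho>0 by (auto simp: \<beta>_def \<rho>_def a_def)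
  have lead\<beta>: "\<bar>fls_lead \<beta>\<bar> = 1"
    using less.prems(1)[of 0 \<beta>] cq1 by simp
  have lead\<rho>: "\<bar>fls_lead \<rho>\<bar> = 1"
    using lead\<beta> by (simp add: \<beta>_def fls_lead_inverse)
  have sub\<rho>: "fls_subdegree \<rho> > 0"
    using fls_subdegree_minus_poly_part[of \<alpha>] \<rho>0 by (simp add: \<rho>_def a_def)
  show ?case
  \<comment> \<open>If \<open>p' = 0\<close>, then \<open>?\<delta>\<close> is \<open>q\<close>
    times \<open>\<rho>\<close>, and \<open>\<rho>\<close> has leading coefficient 1 or -1.
    Otherwise the induction hypothesis is applied to \<open>\<beta>\<close> with \<open>p'\<close>
    in the role of \<open>q\<close>.\<close>
  proof (cases "p' = 0")
    case True
    then show ?thesis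
      by (simp add: \<delta> fls_lead_mult abs_mult lead\<rho>)
  next
    case False
    let ?\<delta>' = "poly_to_fls p' * \<beta> - poly_to_fls q"
    have q\<rho>: "poly_to_fls q * \<rho> = poly_to_fls p' + ?\<delta>"
      by (simp add: \<delta>)
    have "fls_subdegree (poly_to_fls p') < fls_subdegree ?\<delta>"
      using less.prems(4) by simp
    \<comment> \<open>\<open>?\<delta>\<close> has positive order and so cannot disturb the leading
      term of the nonzero polynomial \<open>p'\<close>. As \<rho> has positive order, this makes the
      degree of \<open>p'\<close> smaller than that of \<open>q\<close>.\<close>
    then have lead: "fls_lead (poly_to_fls q * \<rho>) = lead_coeff p'"
      and "fls_subdegree (poly_to_fls q * \<rho>) = - int (degree p')"
      unfolding q\<rho> using False by (simp_all add: fls_lead_add)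
    then have deg: "int (degree q) = int (degree p') + fls_subdegree \<rho>"
      using less.prems(2) \<rho>0 by simp
    \<comment> \<open>Since \<open>\<rho> * \<beta> = 1\<close>, the new error is (p' - q \<rho>)
      \<beta>.\<close>
    have \<delta>': "?\<delta>' = - ?\<delta> * \<beta>"
      unfolding \<delta> \<beta>_def using \<rho>0 by (simp add: field_simps)
    have \<beta>0: "\<beta> \<noteq> 0"
      using \<rho>0 unfolding \<beta>_def by (metis inverse_zero inverse_inverse_eq)
    have "fls_subdegree ?\<delta>' = fls_subdegree ?\<delta> - fls_subdegree \<rho>"
      unfolding \<delta>' using \<delta>0 \<beta>0 by (subst fls_subdegree_mult) (auto simp: \<beta>_def simp del: minus_diff_eq)
    then have sub: "fls_subdegree ?\<delta>' > int (degree p')"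
      using less.prems(4) deg by linarith
    have "\<bar>fls_lead ?\<delta>'\<bar> = \<bar>lead_coeff p'\<bar>"
    proof (rule less.hyps)
      show "degree p' < degree q"
        using deg sub\<rho> by linarith
      show "\<bar>fls_lead \<gamma>\<bar> = 1" if "complete_quotient \<beta> (Suc n) = Some \<gamma>" for n \<gamma>
        using less.prems(1)[of "Suc n" \<gamma>] that complete_quotient_step[OF cq1, of "Suc n"] by simp
      show "poly_to_fls p' * \<beta> \<noteq> poly_to_fls q"
      proof
        assume "poly_to_fls p' * \<beta> = poly_to_fls q"
        then have "- ?\<delta> * \<beta> = 0"
          unfolding \<delta>'[symmetric] by simp
        with \<delta>0 \<beta>0 show False
          by simp
      qed
    qed (use False sub in auto)
    moreover have "\<bar>fls_lead ?\<delta>'\<bar> = \<bar>fls_lead ?\<delta>\<bar>"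
      unfolding \<delta>' by (simp only: fls_lead_mult fls_lead_uminus abs_mult lead\<beta> abs_minus mult_1_right)
    moreover have "\<bar>lead_coeff p'\<bar> = \<bar>lead_coeff q\<bar>"
      unfolding lead[symmetric] by (simp add: fls_lead_mult abs_mult lead\<rho>)
    ultimately show ?thesis
      by simp
  qed
qed

subsection \<open>Laurent series with integer coefficients\<close>

definition integral_fls :: "'a::ring_1 fls \<Rightarrow> bool" where
  "integral_fls \<alpha> \<longleftrightarrow> (\<forall>k. \<alpha> $$ k \<in> \<int>)"

lemma integral_fls_1 [simp]: "integral_fls 1"
  by (simp add: integral_fls_def)

lemma integral_fls_add: "integral_fls \<alpha> \<Longrightarrow> integral_fls \<beta> \<Longrightarrow> integral_fls (\<alpha> + \<beta>)"
  by (simp add: integral_fls_def)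

lemma integral_fls_diff: "integral_fls \<alpha> \<Longrightarrow> integral_fls \<beta> \<Longrightarrow> integral_fls (\<alpha> - \<beta>)"
  by (simp add: integral_fls_def)

lemma integral_fls_mult: "integral_fls \<alpha> \<Longrightarrow> integral_fls \<beta> \<Longrightarrow> integral_fls (\<alpha> * \<beta>)"
  by (simp add: integral_fls_def fls_times_nth(2) Ints_sum Ints_mult)

lemma integral_fls_prod: "(\<And>i. i \<in> A \<Longrightarrow> integral_fls (g i)) \<Longrightarrow> integral_fls (prod g A)"
  for g :: "_ \<Rightarrow> 'a::comm_ring_1 fls"
  by (induction A rule: infinite_finite_induct) (simp_all add: integral_fls_mult)

text \<open>The recursion for the coefficients of an inverse series divides only by the constant
  term.\<close>

lemma fps_inverse_nth_Ints:
  fixes F :: "'a::field fps"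
  assumes F: "\<And>n. fps_nth F n \<in> \<int>" and inv: "inverse (fps_nth F 0) \<in> \<int>"
  shows "fps_nth (inverse F) n \<in> \<int>"
proof (induction n rule: less_induct)
  case (less n)
  show ?case
  proof (cases n)
    case (Suc m)
    have "fps_right_inverse_constructor F (inverse (fps_nth F 0)) k \<in> \<int>" if "k < n" for k
      using less[OF that] by (simp add: fps_inverse_def)
    with F inv show ?thesis
      by (auto simp: fps_inverse_def Suc intro!: Ints_mult Ints_sum)
  qed (use inv in \<open>simp add: fps_inverse_def\<close>)
qed

lemma integral_fls_inverse:
  fixes \<alpha> :: "'a::field fls"
  assumes "integral_fls \<alpha>" "inverse (fls_lead \<alpha>) \<in> \<int>"
  shows "integral_fls (inverse \<alpha>)"
proof -
  have "fps_nth (inverse (fls_base_factor_to_fps \<alpha>)) n \<in> \<int>" for n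
    using assms
    by (intro fps_inverse_nth_Ints)
      (simp_all add: integral_fls_def fls_lead_def fls_base_factor_to_fps_nth)
  then show ?thesis
    by (simp add: integral_fls_def fls_inverse_def)
qed

lemma Ints_unit_abs:
  fixes x :: "'a::linordered_field"
  assumes "x \<in> \<int>" "inverse x \<in> \<int>" "x \<noteq> 0"
  shows "\<bar>x\<bar> = 1"
proof -
  obtain m n where mn: "x = of_int m" "inverse x = of_int n"
    using assms by (auto elim!: Ints_cases)
  have "of_int (m * n) = (1 :: 'a)"
    using mn assms(3) by (metis of_int_mult right_inverse)
  then have "m * n = 1"
    by (simp only: of_int_eq_1_iff)
  then have "\<bar>m\<bar> = 1"
    by (auto simp: zmult_eq_1_iff)
  then show ?thesis
    using mn(1) by (metis of_int_1 of_int_abs)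
qed

lemma integral_fls_poly_to_fls: "(\<And>n. coeff p n \<in> \<int>) \<Longrightarrow> integral_fls (poly_to_fls p)"
  by (simp add: integral_fls_def poly_to_fls_nth)

lemma specializable_coeff_Ints:
  assumes "specializable (partial_quotient \<alpha>)" "complete_quotient \<alpha> n = Some \<beta>"
  shows "coeff (poly_part \<beta>) k \<in> \<int>"
proof -
  obtain P where "poly_part \<beta> = map_poly rat_of_int P"
    using assms by (auto simp: specializable_def partial_quotient_def)
  then show ?thesis
    by (simp add: coeff_map_poly del: coeff_poly_part)
qed

text \<open>Subtracting an integral polynomial part leaves an integral remainder \<rho>. The leading
  coefficient of its inverse belongs to the next partial quotient, hence is an integer too. So
  \<rho> has a unit of the integers as leading coefficient, which also makes its inverse
  integral.\<close>

lemma specializable_complete_quotient: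
  assumes spec: "specializable (partial_quotient \<alpha>)" and int: "integral_fls \<alpha>"
  shows "complete_quotient \<alpha> n = Some \<beta> \<Longrightarrow> integral_fls \<beta> \<and> (n > 0 \<longrightarrow> \<bar>fls_lead \<beta>\<bar> = 1)"
proof (induction n arbitrary: \<beta>)
  case 0
  with int show ?case
    by simp
next
  case (Suc n)
  then obtain \<gamma> where \<gamma>: "complete_quotient \<alpha> n = Some \<gamma>"
    and neq: "\<gamma> \<noteq> poly_to_fls (poly_part \<gamma>)"
    and \<beta>: "\<beta> = inverse (\<gamma> - poly_to_fls (poly_part \<gamma>))"
    by (auto split: option.splits if_splits)
  define \<rho> where "\<rho> = \<gamma> - poly_to_fls (poly_part \<gamma>)"
  have \<rho>: "integral_fls \<rho>"
    unfolding \<rho>_def using Suc.IH[OF \<gamma>] specializable_coeff_Ints[OF spec \<gamma>]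
    by (intro integral_fls_diff integral_fls_poly_to_fls) simp_all
  \<comment> \<open>Negative order puts the leading term of \<beta> inside its polynomial part,
    where the hypothesis on partial quotients applies.\<close>
  have "fls_subdegree \<beta> < 0"
    using fls_subdegree_minus_poly_part[OF neq] by (simp add: \<beta>)
  then have "fls_lead \<beta> = coeff (poly_part \<beta>) (nat (- fls_subdegree \<beta>))"
    by (simp add: fls_lead_def)
  then have "fls_lead \<beta> \<in> \<int>"
    using specializable_coeff_Ints[OF spec Suc.prems] by (simp only:)
  then have lead: "inverse (fls_lead \<rho>) \<in> \<int>"
    by (simp add: \<beta> \<rho>_def fls_lead_inverse)
  moreover have "fls_lead \<rho> \<in> \<int>"
    using \<rho> by (simp add: integral_fls_def fls_lead_def)
  moreover have "fls_lead \<rho> \<noteq> 0"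
    using neq by (simp add: \<rho>_def)
  ultimately have "\<bar>fls_lead \<rho>\<bar> = 1"
    by (intro Ints_unit_abs)
  with \<rho> lead show ?case
    by (simp add: \<beta> integral_fls_inverse fls_lead_inverse flip: \<rho>_def)
qed

subsection \<open>The infinite product\<close>

definition int_fls :: "int poly \<Rightarrow> rat fls" where
  "int_fls p = poly_to_fls (map_poly of_int p)"

lemma int_fls_nth: "int_fls p $$ k = (if k \<le> 0 then of_int (coeff p (nat (- k))) else 0)"
  by (simp add: int_fls_def poly_to_fls_nth coeff_map_poly)

lemma int_fls_1 [simp]: "int_fls 1 = 1"
  by (rule fls_eqI) (simp add: int_fls_nth)

lemma int_fls_add: "int_fls (p + q) = int_fls p + int_fls q"
  by (rule fls_eqI) (simp add: int_fls_nth)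

lemma int_fls_diff: "int_fls (p - q) = int_fls p - int_fls q"
  by (rule fls_eqI) (simp add: int_fls_nth)

lemma int_fls_mult: "int_fls (p * q) = int_fls p * int_fls q"
proof -
  have "map_poly rat_of_int (p * q) = map_poly of_int p * map_poly of_int q"
    by (rule poly_eqI) (simp add: coeff_mult coeff_map_poly)
  then show ?thesis
    by (simp add: int_fls_def poly_to_fls_mult)
qed

lemma int_fls_prod: "int_fls (prod g A) = (\<Prod>i\<in>A. int_fls (g i))"
  by (induction A rule: infinite_finite_induct) (simp_all add: int_fls_mult)

lemma fls_subdegree_int_fls [simp]: "fls_subdegree (int_fls p) = - int (degree p)"
  by (simp add: int_fls_def degree_map_poly)

lemma fls_lead_int_fls [simp]: "fls_lead (int_fls p) = of_int (lead_coeff p)"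
  by (simp add: int_fls_def coeff_map_poly degree_map_poly)

lemma int_fls_eq_0_iff [simp]: "int_fls p = 0 \<longleftrightarrow> p = 0"
  by (simp add: int_fls_def map_poly_eq_0_iff)

lemma integral_int_fls: "integral_fls (int_fls p)"
  by (simp add: integral_fls_def int_fls_nth)

section \<open>Iterates and partial products\<close>

lemma poly_iterate_0 [simp]: "poly_iterate f 0 = [:0, 1:]"
  by (simp add: poly_iterate_def)

lemma poly_iterate_Suc [simp]: "poly_iterate f (Suc n) = pcompose f (poly_iterate f n)"
  by (simp add: poly_iterate_def)

lemma degree_poly_iterate: "degree (poly_iterate f n) = degree f ^ n"
  by (induction n) (simp_all add: degree_pcompose)

lemma poly_iterate_nonzero: "degree f > 0 \<Longrightarrow> poly_iterate f n \<noteq> 0"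
  using degree_poly_iterate[of f n] by auto

lemma abs_lead_coeff_poly_iterate:
  assumes "degree f > 0" "\<bar>lead_coeff f\<bar> = 1"
  shows "\<bar>lead_coeff (poly_iterate f n)\<bar> = 1"
  using assms by (induction n) (simp_all add: lead_coeff_comp degree_poly_iterate abs_mult power_abs)

definition iterate_num :: "int poly \<Rightarrow> nat \<Rightarrow> int poly" where
  "iterate_num f m = (\<Prod>i<m. poly_iterate f i + 1)"

definition iterate_den :: "int poly \<Rightarrow> nat \<Rightarrow> int poly" where
  "iterate_den f m = (\<Prod>i<m. poly_iterate f i)"

definition partial_product :: "int poly \<Rightarrow> nat \<Rightarrow> rat fls" where
  "partial_product f m = (\<Prod>i<m. 1 + 1 / int_fls (poly_iterate f i))"

lemma iterate_den_nonzero: "degree f > 0 \<Longrightarrow> iterate_den f m \<noteq> 0"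
  by (simp add: iterate_den_def poly_iterate_nonzero)

text \<open>The degrees of the iterates sum to 1 + 2 + ... + 2^(m-1); adding 1 avoids truncated
  subtraction.\<close>

lemma degree_iterate_den:
  assumes "degree f = 2"
  shows "degree (iterate_den f m) + 1 = 2 ^ m"
proof (induction m)
  case (Suc m)
  have "degree (iterate_den f (Suc m)) = degree (iterate_den f m) + 2 ^ m"
    using assms iterate_den_nonzero[of f m] poly_iterate_nonzero[of f m]
    by (simp add: iterate_den_def degree_mult_eq degree_poly_iterate del: prod_zero_iff)
  with Suc show ?case
    by simp
qed (simp add: iterate_den_def)

lemma abs_lead_coeff_iterate_den:
  assumes "degree f > 0" "\<bar>lead_coeff f\<bar> = 1"
  shows "\<bar>lead_coeff (iterate_den f m)\<bar> = 1"
  using assms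
  by (induction m) (simp_all add: iterate_den_def lead_coeff_mult abs_mult abs_lead_coeff_poly_iterate)

lemma partial_product_eq:
  assumes "degree f > 0"
  shows "partial_product f m = int_fls (iterate_num f m) / int_fls (iterate_den f m)"
proof -
  have "1 + 1 / int_fls (poly_iterate f i) = int_fls (poly_iterate f i + 1) / int_fls (poly_iterate f i)"
    for i
    using poly_iterate_nonzero[OF assms, of i] by (simp add: int_fls_add field_simps)
  then show ?thesis
    by (simp add: partial_product_def iterate_num_def iterate_den_def int_fls_prod prod_dividef)
qed

lemma partial_product_lead:
  assumes "degree f > 0"
  shows "fls_subdegree (partial_product f m) = 0 \<and> fls_lead (partial_product f m) = 1"
proof (induction m)
  case (Suc m)
  let ?u = "1 + 1 / int_fls (poly_iterate f m)"
  have "1 / int_fls (poly_iterate f m) = inverse (int_fls (poly_iterate f m))"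
    by (simp add: divide_inverse)
  then have "fls_subdegree (1 / int_fls (poly_iterate f m)) > 0"
    using assms by (simp add: degree_poly_iterate)
  then have u: "fls_subdegree ?u = 0" "fls_lead ?u = 1"
    by (simp_all add: fls_lead_add) (simp add: fls_lead_def)
  have "?u \<noteq> 0" "partial_product f m \<noteq> 0"
    using u(2) Suc by (metis fls_lead_eq_0_iff zero_neq_one)+
  with Suc u show ?case
    by (simp add: partial_product_def fls_lead_mult)
qed (simp add: partial_product_def fls_lead_def)

lemma partial_product_nth_0: "degree f > 0 \<Longrightarrow> partial_product f m $$ 0 = 1"
  using partial_product_lead[of f m] by (metis fls_lead_def)

lemma partial_product_nonzero: "degree f > 0 \<Longrightarrow> partial_product f m \<noteq> 0"
  using partial_product_nth_0[of f m] by auto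

text \<open>The new factor adds \<open>?P\<close> divided by the \<open>m\<close>-th iterate, a term
  of order 2^m.\<close>

lemma partial_product_nth_Suc:
  assumes "degree f = 2" "k < 2 ^ m"
  shows "partial_product f (Suc m) $$ k = partial_product f m $$ k"
proof -
  let ?P = "partial_product f m" and ?F = "int_fls (poly_iterate f m)"
  have F: "inverse ?F \<noteq> 0"
    using assms by (simp add: poly_iterate_nonzero nonzero_imp_inverse_nonzero del: fls_inverse_eq_0_iff)
  have "fls_subdegree (?P * inverse ?F) = 2 ^ m"
    using assms F partial_product_lead[of f m] partial_product_nonzero[of f m]
    by (simp add: degree_poly_iterate)
  then have "(?P * inverse ?F) $$ k = 0"
    using assms by simp
  then show ?thesis
    by (simp add: partial_product_def algebra_simps divide_inverse)
qed

lemma partial_product_nth_stable: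
  assumes "degree f = 2" "m \<le> n" "k < 2 ^ m"
  shows "partial_product f n $$ k = partial_product f m $$ k"
  using assms(2)
proof (induction n rule: dec_induct)
  case (step j)
  have "(2::int) ^ m \<le> 2 ^ j"
    using step by simp
  then have "k < 2 ^ j"
    using assms(3) by linarith
  then show ?case
    using partial_product_nth_Suc[OF assms(1), of k j] step by simp
qed simp

section \<open>Convergence in the 1/x-adic topology\<close>

lemma fls_LIMSEQ_I:
  fixes \<alpha> :: "'a::group_add fls"
  assumes "\<And>n k. k < int n \<Longrightarrow> X n $$ k = \<alpha> $$ k"
  shows "X \<longlonglongrightarrow> \<alpha>"
proof -
  have le: "dist (X n) \<alpha> \<le> (1 / 2) ^ n" for n
  proof (cases "X n = \<alpha>")
    case False
    then have "int n \<le> fls_subdegree (X n - \<alpha>)"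
      using assms by (intro fls_subdegree_geI) auto
    then show ?thesis
      using False by (auto simp: dist_fls_def power_one_over inverse_eq_divide
          intro!: divide_left_mono power_increasing)
  qed simp
  have "(\<lambda>n. dist (X n) \<alpha>) \<longlonglongrightarrow> 0"
  proof (rule Lim_null_comparison)
    show "\<forall>\<^sub>F n in sequentially. norm (dist (X n) \<alpha>) \<le> (1 / 2) ^ n"
      using le by simp
    show "(\<lambda>n. (1 / 2 :: real) ^ n) \<longlonglongrightarrow> 0"
      by (rule LIMSEQ_realpow_zero) simp_all
  qed
  then show ?thesis
    by (rule tendsto_dist_iff[THEN iffD2])
qed

lemma iterate_product_nth:
  assumes f: "degree f = 2" and k: "k < 2 ^ m"
  shows "iterate_product f $$ k = partial_product f m $$ k"
proof -
  \<comment> \<open>The candidate limit is diagonal: since n < 2^n, the n-th coefficient is already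
    stable in the n-th partial product.\<close>
  define \<alpha> where "\<alpha> = fps_to_fls (Abs_fps (\<lambda>n. partial_product f n $$ int n))"
  have \<alpha>: "\<alpha> $$ k = partial_product f m $$ k" if "k < 2 ^ m" for k m
  proof (cases "k < 0")
    case True
    then show ?thesis
      using partial_product_lead[of f m] f by (simp add: \<alpha>_def)
  next
    case False
    then have "k < 2 ^ nat k"
      using of_nat_less_two_power[of "nat k", where 'a = int] by simp
    then have "partial_product f (nat k) $$ k = partial_product f (max m (nat k)) $$ k"
      by (intro partial_product_nth_stable[OF f, symmetric]) simp_all
    also have "\<dots> = partial_product f m $$ k"
      using that by (intro partial_product_nth_stable[OF f]) simp_all
    finally show ?thesis
      using False by (simp add: \<alpha>_def)
  qed
  \<comment> \<open>\<open>has_prod\<close> requires a nonzero limit. It also takes products over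
    \<open>i \<le> n\<close>, whence the \<open>Suc n\<close> in the convergence statement.\<close>
  have "\<alpha> $$ 0 = 1"
    using \<alpha>[of 0 0] f by (simp add: partial_product_nth_0)
  then have "\<alpha> \<noteq> 0"
    by auto
  moreover have "(\<lambda>n. partial_product f (Suc n)) \<longlonglongrightarrow> \<alpha>"
  proof (rule fls_LIMSEQ_I)
    fix n :: nat and k :: int
    assume "k < int n"
    also have "int n < 2 ^ n"
      by (rule of_nat_less_two_power)
    also have "(2::int) ^ n \<le> 2 ^ Suc n"
      by simp
    finally show "partial_product f (Suc n) $$ k = \<alpha> $$ k"
      by (rule \<alpha>[symmetric])
  qed
  ultimately have "(\<lambda>i. 1 + 1 / int_fls (poly_iterate f i)) has_prod \<alpha>"
    by (simp add: has_prod_def raw_has_prod_def partial_product_def lessThan_Suc_atMost)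
  from has_prod_unique[OF this] have "iterate_product f = \<alpha>"
    by (simp add: iterate_product_def int_fls_def)
  with \<alpha>[OF k] show ?thesis
    by simp
qed

section \<open>Integrality and the leading coefficient of f\<close>

lemma integral_iterate_product:
  assumes "degree f = 2" "\<bar>lead_coeff f\<bar> = 1"
  shows "integral_fls (iterate_product f)"
proof -
  have "inverse (rat_of_int (lead_coeff (poly_iterate f i))) \<in> \<int>" for i
  proof -
    have "\<bar>lead_coeff (poly_iterate f i)\<bar> = 1"
      using assms by (intro abs_lead_coeff_poly_iterate) simp_all
    then have "lead_coeff (poly_iterate f i) = 1 \<or> lead_coeff (poly_iterate f i) = - 1"
      by linarith
    then show ?thesis
      by auto
  qed
  then have "integral_fls (partial_product f m)" for m
    unfolding partial_product_def divide_inverse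
    by (intro integral_fls_prod integral_fls_add integral_fls_mult integral_fls_inverse
        integral_fls_1 integral_int_fls) simp
  then have "partial_product f m $$ k \<in> \<int>" for m k
    by (simp add: integral_fls_def)
  moreover have "iterate_product f $$ k = partial_product f (nat k) $$ k" for k
    using of_nat_less_two_power[of "nat k", where 'a = int]
    by (intro iterate_product_nth[OF assms(1)]) (cases "k < 0"; simp)
  ultimately show ?thesis
    by (simp add: integral_fls_def)
qed

text \<open>With y = 1/x and a the leading coefficient of f, the product starts 1 + y + y^2/a.
  Removing 1 and inverting gives x - 1/a + ..., so 1/a must be an integer.\<close>

lemma specializable_abs_lead_coeff:
  assumes f: "degree f = 2" and spec: "specializable (S_inf f)"
  shows "\<bar>lead_coeff f\<bar> = 1"
proof -
  define \<alpha> where "\<alpha> = iterate_product f"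
  define G where "G = inverse (int_fls f)"
  have G: "fls_subdegree G = 2" "G $$ 2 = inverse (of_int (lead_coeff f))"
  proof -
    show *: "fls_subdegree G = 2"
      using f by (simp add: G_def)
    show "G $$ 2 = inverse (of_int (lead_coeff f))"
      using fls_lead_inverse[of "int_fls f", folded G_def] * by (metis fls_lead_def fls_lead_int_fls)
  qed
  have "int_fls [:0, 1:] = fls_X_inv"
    by (rule fls_eqI) (auto simp: int_fls_nth coeff_pCons split: nat.splits)
  then have "partial_product f 2 = (1 + fls_X) * (1 + G)"
    by (simp add: partial_product_def G_def numeral_2_eq_2 divide_inverse fls_inverse_X_inv)
  then have "partial_product f 2 = 1 + G + fls_shift (- 1) (1 + G)"
    by (simp add: distrib_right fls_X_times_conv_shift)
  then have P: "partial_product f 2 $$ k = (1 + G) $$ k + (1 + G) $$ (k - 1)" for k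
    by simp
  \<comment> \<open>Two factors determine all coefficients of index below 2^2.\<close>
  have \<alpha>: "\<alpha> $$ k = (1 + G) $$ k + (1 + G) $$ (k - 1)" if "k < 4" for k
    unfolding \<alpha>_def P[symmetric] using that by (intro iterate_product_nth[OF f]) simp
  have \<alpha>0: "\<alpha> $$ k = 0" if "k < 0" for k
    using that G by (simp add: \<alpha>)
  have \<alpha>1: "\<alpha> $$ 0 = 1" "\<alpha> $$ 1 = 1" "\<alpha> $$ 2 = inverse (of_int (lead_coeff f))"
    using G by (simp_all add: \<alpha>)
  have "poly_part \<alpha> = 1"
    by (rule poly_eqI) (use \<alpha>0 \<alpha>1 in auto)
  define \<rho> where "\<rho> = \<alpha> - 1"
  define \<beta> where "\<beta> = inverse \<rho>"
  have \<rho>1: "\<rho> $$ 1 = 1" "\<rho> $$ 2 = inverse (of_int (lead_coeff f))"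
    by (simp_all add: \<rho>_def \<alpha>1)
  have sub\<rho>: "fls_subdegree \<rho> = 1"
  proof (rule fls_subdegree_eqI)
    show "\<rho> $$ k = 0" if "k < 1" for k
      using that \<alpha>0[of k] \<alpha>1 by (cases "k = 0") (simp_all add: \<rho>_def)
  qed (simp add: \<rho>1)
  have \<rho>0: "\<rho> \<noteq> 0"
    using \<rho>1 by auto
  then have cq: "complete_quotient \<alpha> 1 = Some \<beta>"
    using \<open>poly_part \<alpha> = 1\<close> by (simp add: \<rho>_def \<beta>_def)
  have "fls_lead \<beta> = 1"
    by (simp add: \<beta>_def fls_lead_inverse) (simp add: fls_lead_def sub\<rho> \<rho>1)
  then have \<beta>1: "fls_subdegree \<beta> = - 1" "\<beta> $$ (- 1) = 1"
    by (simp_all add: \<beta>_def sub\<rho> fls_lead_def)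
  \<comment> \<open>\<open>\<rho> * \<beta> = 1\<close> has coefficient 0 at index 1; the orders 1
    and -1 leave just two terms of the convolution.\<close>
  have "(\<rho> * \<beta>) $$ 1 = (\<Sum>i\<in>{1, 2}. \<rho> $$ i * \<beta> $$ (1 - i))"
    unfolding fls_times_nth(2) sub\<rho> \<beta>1 by (rule sum.cong) auto
  then have "\<beta> $$ 0 + \<rho> $$ 2 = 0"
    using \<rho>0 \<rho>1 \<beta>1 by (simp add: \<beta>_def)
  moreover have "\<beta> $$ 0 \<in> \<int>"
    using specializable_coeff_Ints[of \<alpha> 1 \<beta> 0] spec cq by (simp add: S_inf_def \<alpha>_def)
  ultimately have "inverse (rat_of_int (lead_coeff f)) \<in> \<int>"
    using \<rho>1 Ints_minus by (metis add.inverse_unique add.commute)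
  moreover have "f \<noteq> 0"
    using f by auto
  ultimately have "\<bar>rat_of_int (lead_coeff f)\<bar> = 1"
    by (intro Ints_unit_abs) simp_all
  then show ?thesis
    by linarith
qed

text \<open>
  With \<open>N / D\<close> the \<open>m\<close>-th partial product, \<open>\<alpha> - N / D\<close> has degree \<open>- 2 ^ m\<close>. The bound
  \<open>degree q \<le> degree E\<close> therefore ensures that \<open>q \<alpha> - p\<close> has the same leading term as \<open>E / D\<close>,
  and the second bound says that its degree is less than \<open>- degree q\<close>. The conditions relating \<open>p\<close>
  to \<open>q\<close> only serve to make the property symmetric in \<open>p\<close> and \<open>q\<close>.
\<close>

definition unimodular_approximations :: "int poly \<Rightarrow> bool" where
  "unimodular_approximations f \<longleftrightarrow>
    (\<forall>m p q E. q * iterate_num f m - p * iterate_den f m = E \<longrightarrow> E \<noteq> 0 \<longrightarrow>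
      degree p = degree q \<longrightarrow> \<bar>lead_coeff p\<bar> = \<bar>lead_coeff q\<bar> \<longrightarrow>
      degree q \<le> degree E \<longrightarrow> degree E + degree q + 1 < 2 ^ m \<longrightarrow>
      \<bar>lead_coeff E\<bar> = \<bar>lead_coeff q\<bar>)"

lemma unimodular_approximationsD:
  assumes "unimodular_approximations f" "q * iterate_num f m - p * iterate_den f m = E" "E \<noteq> 0"
    and "degree p = degree q" "\<bar>lead_coeff p\<bar> = \<bar>lead_coeff q\<bar>"
    and "degree q \<le> degree E" "degree E + degree q + 1 < 2 ^ m"
  shows "\<bar>lead_coeff E\<bar> = \<bar>lead_coeff q\<bar>"
  using assms unfolding unimodular_approximations_def by blast

lemma specializable_imp_unimodular_approximations:
  assumes f: "degree f = 2" and spec: "specializable (S_inf f)"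
  shows "unimodular_approximations f"
  unfolding unimodular_approximations_def
proof (intro allI impI)
  fix m p q E
  assume E_def: "q * iterate_num f m - p * iterate_den f m = E"
    and E: "E \<noteq> 0" "degree q \<le> degree E" "degree E + degree q + 1 < 2 ^ m"
    and lead_eq: "\<bar>lead_coeff p\<bar> = \<bar>lead_coeff q\<bar>"
  have q: "q \<noteq> 0"
    using lead_eq E(1) by (auto simp flip: E_def)
  define \<alpha> where "\<alpha> = iterate_product f"
  define \<epsilon> where "\<epsilon> = \<alpha> - partial_product f m"
  let ?D = "int_fls (iterate_den f m)"
  let ?\<eta> = "int_fls E / ?D"
  have lead: "\<bar>lead_coeff f\<bar> = 1"
    by (rule specializable_abs_lead_coeff[OF f spec])
  have D: "iterate_den f m \<noteq> 0"
    using f by (simp add: iterate_den_nonzero)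
  have "?\<eta> = int_fls q * partial_product f m - int_fls p"
    using D f by (simp add: partial_product_eq int_fls_diff int_fls_mult field_simps flip: E_def)
  then have \<delta>: "int_fls q * \<alpha> - int_fls p = ?\<eta> + int_fls q * \<epsilon>"
    by (simp add: \<epsilon>_def algebra_simps)
  have degD: "int (degree (iterate_den f m)) = 2 ^ m - 1"
    using arg_cong[OF degree_iterate_den[OF f, of m], of int] by simp
  have inv: "inverse ?D \<noteq> 0"
    using D by (simp add: nonzero_imp_inverse_nonzero del: fls_inverse_eq_0_iff)
  have \<eta>: "?\<eta> \<noteq> 0" "fls_subdegree ?\<eta> = 2 ^ m - 1 - int (degree E)"
    using E(1) inv D by (simp_all add: divide_inverse degD del: fls_inverse_eq_0_iff)
  \<comment> \<open>\<open>q * \<epsilon>\<close> has order at least 2^m - deg q, which exceeds 2^m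
    - 1 - deg E because deg q \<le> deg E.\<close>
  have "int_fls q * \<epsilon> = 0 \<or> fls_subdegree ?\<eta> < fls_subdegree (int_fls q * \<epsilon>)"
  proof (cases "\<epsilon> = 0")
    case False
    then have "2 ^ m \<le> fls_subdegree \<epsilon>"
      by (intro fls_subdegree_geI) (simp_all add: \<epsilon>_def \<alpha>_def iterate_product_nth[OF f])
    then show ?thesis
      using False q E(2) \<eta> by simp
  qed simp
  note sum = fls_lead_add[OF \<eta>(1) this, folded \<delta>]
  have "int (degree E + degree q + 1) < int (2 ^ m)"
    using E(3) by (simp only: of_nat_less_iff)
  then have "int (degree q) < fls_subdegree (int_fls q * \<alpha> - int_fls p)"
    unfolding sum \<eta> by simp
  moreover have "int_fls q * \<alpha> \<noteq> int_fls p"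
  proof
    assume "int_fls q * \<alpha> = int_fls p"
    then have "fls_lead ?\<eta> = 0"
      unfolding sum(1)[symmetric] by simp
    with \<eta>(1) show False
      by (simp only: fls_lead_eq_0_iff)
  qed
  moreover have "\<bar>fls_lead \<beta>\<bar> = 1" if "complete_quotient \<alpha> (Suc n) = Some \<beta>" for n \<beta>
    using specializable_complete_quotient[of \<alpha> "Suc n" \<beta>] that spec
      integral_iterate_product[OF f lead] by (simp add: S_inf_def \<alpha>_def)
  ultimately have "\<bar>fls_lead (int_fls q * \<alpha> - int_fls p)\<bar> = \<bar>rat_of_int (lead_coeff q)\<bar>"
    using best_approximation_lead[of \<alpha> "map_poly of_int q" "map_poly of_int p"] q
    by (simp add: degree_map_poly coeff_map_poly map_poly_eq_0_iff flip: int_fls_def)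
  then have "\<bar>rat_of_int (lead_coeff E)\<bar> / \<bar>rat_of_int (lead_coeff (iterate_den f m))\<bar>
      = \<bar>rat_of_int (lead_coeff q)\<bar>"
    unfolding sum by (simp add: fls_lead_divide)
  moreover have "\<bar>rat_of_int (lead_coeff (iterate_den f m))\<bar> = 1"
    using abs_lead_coeff_iterate_den[of f m] f lead by (metis of_int_1 of_int_abs zero_less_numeral)
  ultimately have "rat_of_int \<bar>lead_coeff E\<bar> = of_int \<bar>lead_coeff q\<bar>"
    by simp
  then show "\<bar>lead_coeff E\<bar> = \<bar>lead_coeff q\<bar>"
    by (simp only: of_int_eq_iff)
qed

subsection \<open>The symmetry\<close>

text \<open>This is the conjugate of \<open>f\<close> by the involution x \<mapsto> -1 - x, so
  iteration commutes with it. A value g becomes -(g + 1) and g + 1 becomes -g, which is why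
  numerators and denominators trade places.\<close>

definition mirror :: "int poly \<Rightarrow> int poly" where
  "mirror f = - 1 - pcompose f [:- 1, - 1:]"

lemma poly_iterate_mirror:
  "poly_iterate (mirror f) n = - 1 - pcompose (poly_iterate f n) [:- 1, - 1:]"
proof (induction n)
  case 0
  show ?case
    by (simp add: pcompose_pCons one_pCons)
next
  case (Suc n)
  let ?g = "pcompose (poly_iterate f n) [:- 1, - 1:]"
  have "pcompose [:- 1, - 1:] (- 1 - ?g) = ?g"
    by (simp add: pcompose_pCons one_pCons)
  then have "pcompose (pcompose f [:- 1, - 1:]) (- 1 - ?g) = pcompose f ?g"
    by (simp flip: pcompose_assoc)
  with Suc show ?case
    by (simp add: mirror_def pcompose_diff pcompose_uminus pcompose_1 pcompose_assoc)
qed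

lemma iterate_num_0: "iterate_num f 0 = 1"
  by (simp add: iterate_num_def)

lemma iterate_num_Suc: "iterate_num f (Suc m) = iterate_num f m * (poly_iterate f m + 1)"
  by (simp add: iterate_num_def)

lemma iterate_den_0: "iterate_den f 0 = 1"
  by (simp add: iterate_den_def)

lemma iterate_den_Suc: "iterate_den f (Suc m) = iterate_den f m * poly_iterate f m"
  by (simp add: iterate_den_def)

lemma iterate_num_mirror:
  "iterate_num (mirror f) m = (- 1) ^ m * pcompose (iterate_den f m) [:- 1, - 1:]"
  by (induction m)
    (simp_all add: iterate_num_0 iterate_den_0 iterate_num_Suc iterate_den_Suc poly_iterate_mirror
      pcompose_1 pcompose_mult)

lemma iterate_den_mirror:
  "iterate_den (mirror f) m = (- 1) ^ m * pcompose (iterate_num f m) [:- 1, - 1:]"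
  by (induction m)
    (simp_all add: iterate_num_0 iterate_den_0 iterate_num_Suc iterate_den_Suc poly_iterate_mirror
      pcompose_1 pcompose_mult pcompose_add algebra_simps)

text \<open>The substitution preserves degrees, and leading coefficients up to sign. As it
  interchanges numerator and denominator, \<open>p\<close> and \<open>q\<close> swap roles.\<close>

lemma unimodular_approximations_mirror:
  assumes "unimodular_approximations f"
  shows "unimodular_approximations (mirror f)"
  unfolding unimodular_approximations_def
proof (intro allI impI)
  fix m p q E
  let ?g = "[:- 1, - 1:] :: int poly"
  assume E: "q * iterate_num (mirror f) m - p * iterate_den (mirror f) m = E"
    and E0: "E \<noteq> 0"
    and deg: "degree p = degree q" "degree q \<le> degree E" "degree E + degree q + 1 < 2 ^ m"
    and lead: "\<bar>lead_coeff p\<bar> = \<bar>lead_coeff q\<bar>"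
  have gg: "pcompose (pcompose r ?g) ?g = r" for r
    by (simp add: pcompose_pCons flip: pcompose_assoc)
  have deg_g: "degree (pcompose r ?g) = degree r" for r
    by (simp add: degree_pcompose)
  have abs_lead: "\<bar>lead_coeff (pcompose r ?g)\<bar> = \<bar>lead_coeff r\<bar>" for r
    by (subst lead_coeff_comp) (simp_all add: abs_mult power_abs)
  \<comment> \<open>The factor \<open>(- 1) ^ m\<close> comes from the mirrored products, the extra
    minus from swapping \<open>p\<close> and \<open>q\<close>.\<close>
  let ?E = "- ((- 1) ^ m) * pcompose E ?g"
  have sgn: "(- 1) ^ m = (1 :: int poly) \<or> (- 1) ^ m = (- 1 :: int poly)"
    by (cases "even m") simp_all
  have deg_E: "degree ?E = degree E"
    using sgn by (auto simp: degree_pcompose)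
  have lead_E: "\<bar>lead_coeff ?E\<bar> = \<bar>lead_coeff E\<bar>"
    using sgn abs_lead[of E] by auto
  have "\<bar>lead_coeff ?E\<bar> = \<bar>lead_coeff (pcompose p ?g)\<bar>"
  proof (rule unimodular_approximationsD[OF assms])
    show "pcompose p ?g * iterate_num f m - pcompose q ?g * iterate_den f m = ?E"
      using sgn by (auto simp: iterate_num_mirror iterate_den_mirror pcompose_diff pcompose_mult
          pcompose_uminus pcompose_1 gg simp flip: E)
    show "?E \<noteq> 0"
      using lead_E E0 by (metis abs_eq_0 leading_coeff_0_iff)
    show "degree (pcompose q ?g) = degree (pcompose p ?g)"
      using deg(1) by (simp only: deg_g)
    show "\<bar>lead_coeff (pcompose q ?g)\<bar> = \<bar>lead_coeff (pcompose p ?g)\<bar>"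
      by (simp only: abs_lead lead)
    show "degree (pcompose p ?g) \<le> degree ?E" "degree ?E + degree (pcompose p ?g) + 1 < 2 ^ m"
      using deg by (simp_all only: deg_g deg_E)
  qed
  then show "\<bar>lead_coeff E\<bar> = \<bar>lead_coeff q\<bar>"
    by (simp only: lead_E abs_lead lead)
qed

subsection \<open>Explicit approximations\<close>

text \<open>Here and in the next four lemmas \<open>?p\<close> and \<open>?q\<close> are monic,
  while the leading coefficient of \<open>?E\<close> is not a unit: -4, 3, -2, 2 and 2 in turn. The
  degree bound is just met: 9 + 5 + 1 and 10 + 4 + 1 are below 2^4, and 22 + 8 + 1 is below
  2^5.\<close>

lemma not_unimodular_approximations_0_1: "\<not> unimodular_approximations [:1, 0, 1:]"
proof
  let ?f = "[:1, 0, 1:] :: int poly"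
  let ?q = "[:1, -1, 0, 4, -1, 1:] :: int poly"
  let ?p = "[:4, 2, 4, 4, 0, 1:] :: int poly"
  let ?E = "[:36, -40, 34, -40, 34, -36, 16, -16, 4, -4:] :: int poly"
  assume *: "unimodular_approximations ?f"
  have "?q * iterate_num ?f 4 - ?p * iterate_den ?f 4 = ?E"
    by (simp add: iterate_num_0 iterate_den_0 iterate_num_Suc iterate_den_Suc pcompose_pCons
        eval_nat_numeral one_pCons)
  from unimodular_approximationsD[OF * this] show False
    by simp
qed

lemma not_unimodular_approximations_1_1: "\<not> unimodular_approximations [:1, 1, 1:]"
proof
  let ?f = "[:1, 1, 1:] :: int poly"
  let ?q = "[:1, -1, 3, 2, 1:] :: int poly"
  let ?p = "[:3, 4, 6, 3, 1:] :: int poly"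
  let ?E = "[:112, 191, 361, 420, 446, 350, 242, 125, 54, 15, 3:] :: int poly"
  assume *: "unimodular_approximations ?f"
  have "?q * iterate_num ?f 4 - ?p * iterate_den ?f 4 = ?E"
    by (simp add: iterate_num_0 iterate_den_0 iterate_num_Suc iterate_den_Suc pcompose_pCons
        eval_nat_numeral one_pCons)
  from unimodular_approximationsD[OF * this] show False
    by simp
qed

lemma not_unimodular_approximations_1_0: "\<not> unimodular_approximations [:0, 1, 1:]"
proof
  let ?f = "[:0, 1, 1:] :: int poly"
  let ?q = "[:-1, 1, 2, 1, -1, -1, 1, 2, 1:] :: int poly"
  let ?p = "[:3, 3, 2, 0, 0, 2, 4, 3, 1:] :: int poly"
  let ?E = "[:-1, -4, -13, -39, -106, -259, -573, -1158, -2142, -3614, -5522, -7572,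
    -9228, -9898, -9250, -7447, -5094, -2907, -1349, -490, -131, -23, -2:] :: int poly"
  assume *: "unimodular_approximations ?f"
  have "?q * iterate_num ?f 5 - ?p * iterate_den ?f 5 = ?E"
    by (simp add: iterate_num_0 iterate_den_0 iterate_num_Suc iterate_den_Suc pcompose_pCons
        eval_nat_numeral one_pCons)
  from unimodular_approximationsD[OF * this] show False
    by simp
qed

lemma not_unimodular_approximations_m1_0: "\<not> unimodular_approximations [:0, -1, 1:]"
proof
  let ?f = "[:0, -1, 1:] :: int poly"
  let ?q = "[:-1, 1, -2, 3, 1, -11, 13, -6, 1:] :: int poly"
  let ?p = "[:-1, -1, -2, 6, -6, -2, 8, -5, 1:] :: int poly"
  let ?E = "[:-1, 0, -1, 3, -2, -7, 17, -26, 2, 84, -136, -20, 322,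
    -380, -8, 455, -462, 95, 191, -200, 91, -21, 2:] :: int poly"
  assume *: "unimodular_approximations ?f"
  have "?q * iterate_num ?f 5 - ?p * iterate_den ?f 5 = ?E"
    by (simp add: iterate_num_0 iterate_den_0 iterate_num_Suc iterate_den_Suc pcompose_pCons
        eval_nat_numeral one_pCons)
  from unimodular_approximationsD[OF * this] show False
    by simp
qed

lemma not_unimodular_approximations_m1_m1: "\<not> unimodular_approximations [:-1, -1, 1:]"
proof
  let ?f = "[:-1, -1, 1:] :: int poly"
  let ?q = "[:-2, 4, 9, -27, 1, 19, -5, -3, 1:] :: int poly"
  let ?p = "[:-1, 9, -6, -21, 13, 13, -7, -2, 1:] :: int poly"
  let ?E = "[:0, 1, 7, -26, -155, 219, 998, -1139, -2895, 3513, 4121, -6117,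
    -2557, 5991, -115, -3169, 1012, 748, -487, 0, 70, -21, 2:] :: int poly"
  assume *: "unimodular_approximations ?f"
  have "?q * iterate_num ?f 5 - ?p * iterate_den ?f 5 = ?E"
    by (simp add: iterate_num_0 iterate_den_0 iterate_num_Suc iterate_den_Suc pcompose_pCons
        eval_nat_numeral one_pCons)
  from unimodular_approximationsD[OF * this] show False
    by simp
qed

text \<open>For the convergent x / (x - 1) two factors give (x^2 - 1)(f + 1) - x^2 f = x^2 - 1 - f,
  whose leading coefficient is -b.\<close>

lemma unimodular_approximations_linear_coeff:
  assumes "unimodular_approximations [:c, b, 1:]" "b \<noteq> 0"
  shows "\<bar>b\<bar> = 1"
proof -
  let ?f = "[:c, b, 1:]" and ?q = "[:- 1, 1:] :: int poly" and ?p = "[:0, 1:] :: int poly"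
  let ?E = "[:- c - 1, - b:]"
  have "?q * iterate_num ?f 2 - ?p * iterate_den ?f 2 = ?E"
    by (simp add: iterate_num_0 iterate_den_0 iterate_num_Suc iterate_den_Suc pcompose_pCons
        eval_nat_numeral one_pCons)
  from unimodular_approximationsD[OF assms(1) this] show ?thesis
    using assms(2) by simp
qed

text \<open>For b = 0 the previous \<open>?E\<close> is constant, so its degree is below that of
  \<open>?q\<close>. A third factor raises the degree to 4 and brings out the leading coefficient
  -c.\<close>

lemma unimodular_approximations_linear_coeff_0:
  assumes "unimodular_approximations [:c, 0, 1:]" "c \<noteq> 0"
  shows "\<bar>c\<bar> = 1"
proof -
  let ?f = "[:c, 0, 1:]" and ?q = "[:- 1, 1:] :: int poly" and ?p = "[:0, 1:] :: int poly"
  let ?E = "[:- 1 - 2 * c - 2 * c ^ 2 - c ^ 3, 0, - c - 2 * c ^ 2, 0, - c:]"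
  have "?q * iterate_num ?f 3 - ?p * iterate_den ?f 3 = ?E"
    by (simp add: iterate_num_0 iterate_den_0 iterate_num_Suc iterate_den_Suc pcompose_pCons
        eval_nat_numeral one_pCons algebra_simps)
  from unimodular_approximationsD[OF assms(1) this] show ?thesis
    using assms(2) by simp
qed

lemma unimodular_approximations_linear_coeff_1:
  assumes "unimodular_approximations [:c, 1, 1:]"
  shows "c = 0 \<or> c = 1"
proof (rule ccontr)
  assume c: "\<not> (c = 0 \<or> c = 1)"
  \<comment> \<open>The next convergent after 1/1 and x / (x - 1), with partial quotient x + 2 - c:
    \<open>?q\<close> is (x - 1)(x + 2 - c) + 1 and \<open>?p\<close> is x (x + 2 - c) + 1.\<close>
  let ?f = "[:c, 1, 1:]" and ?q = "[:c - 1, 1 - c, 1:]" and ?p = "[:1, 2 - c, 1:]"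
  let ?E = "[:c ^ 4 + 2 * c ^ 3 - 2 * c - 1, 2 * c ^ 3 - 3 * c - 2, 2 * c ^ 3 + c ^ 2 - 2 * c - 2,
    2 * c ^ 2 - 2 * c - 1, c * (c - 1):]"
  have "?q * iterate_num ?f 3 - ?p * iterate_den ?f 3 = ?E"
    by (simp add: iterate_num_0 iterate_den_0 iterate_num_Suc iterate_den_Suc pcompose_pCons
        eval_nat_numeral one_pCons algebra_simps)
  from unimodular_approximationsD[OF assms this] have "\<bar>c * (c - 1)\<bar> = 1"
    using c by simp
  then have "\<bar>c\<bar> = 1" "\<bar>c - 1\<bar> = 1"
    using abs_zmult_eq_1[of c "c - 1"] abs_zmult_eq_1[of "c - 1" c] by (simp_all add: mult.commute)
  with c show False
    by linarith
qed

lemma unimodular_approximations_linear_coeff_m1: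
  assumes "unimodular_approximations [:c, - 1, 1:]"
  shows "c = 0 \<or> c = - 1"
proof (rule ccontr)
  assume c: "\<not> (c = 0 \<or> c = - 1)"
  \<comment> \<open>Same construction, now with partial quotient -x - c.\<close>
  let ?f = "[:c, - 1, 1:]" and ?q = "[:c + 1, 1 - c, - 1:]" and ?p = "[:1, - c, - 1:]"
  let ?E = "[:c ^ 4 + 2 * c ^ 3 + 2 * c ^ 2 + 2 * c + 1, 2 + c - 2 * c ^ 2 - 2 * c ^ 3,
    3 * c ^ 2 + 2 * c ^ 3, - 1 - 2 * c - 2 * c ^ 2, c * (c + 1):]"
  have "?q * iterate_num ?f 3 - ?p * iterate_den ?f 3 = ?E"
    by (simp add: iterate_num_0 iterate_den_0 iterate_num_Suc iterate_den_Suc pcompose_pCons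
        eval_nat_numeral one_pCons algebra_simps)
  from unimodular_approximationsD[OF assms this] have "\<bar>c * (c + 1)\<bar> = 1"
    using c by (simp add: add_eq_0_iff)
  then have "\<bar>c\<bar> = 1" "\<bar>c + 1\<bar> = 1"
    using abs_zmult_eq_1[of c "c + 1"] abs_zmult_eq_1[of "c + 1" c] by (simp_all add: mult.commute)
  with c show False
    by linarith
qed

section \<open>Classification of the quadratics\<close>

lemma unimodular_approximations_monic:
  assumes f: "unimodular_approximations [:c, b, 1:]"
  shows "b = 0 \<and> (c = 0 \<or> c = - 1)"
proof -
  consider "b = 0" | "b = 1" | "b = - 1"
    using unimodular_approximations_linear_coeff[OF f] by linarith
  then show ?thesis
  proof cases
    case 1
    then have "c = 0 \<or> c = 1 \<or> c = - 1"
      using unimodular_approximations_linear_coeff_0[of c] f by force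
    with 1 f not_unimodular_approximations_0_1 show ?thesis
      by auto
  next
    case 2
    with f have "c = 0 \<or> c = 1"
      by (intro unimodular_approximations_linear_coeff_1) simp
    with 2 f not_unimodular_approximations_1_0 not_unimodular_approximations_1_1 show ?thesis
      by auto
  next
    case 3
    with f have "c = 0 \<or> c = - 1"
      by (intro unimodular_approximations_linear_coeff_m1) simp
    with 3 f not_unimodular_approximations_m1_0 not_unimodular_approximations_m1_m1 show ?thesis
      by auto
  qed
qed

theorem theorem4p1:
  fixes f :: "int poly"
  assumes "degree f = 2"
    and "specializable (S_inf f)"
  shows "f \<in> {[:-2, -2, -1:], [:-1, -2, -1:], [:0, 0, 1:], [:-1, 0, 1:]}"
proof -
  define a b c where "a = coeff f 2" and "b = coeff f 1" and "c = coeff f 0"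
  have f: "f = [:c, b, a:]"
    using assms(1)
    by (intro poly_eqI)
      (auto simp: a_def b_def c_def coeff_pCons numeral_2_eq_2 coeff_eq_0 split: nat.splits)
  have approx: "unimodular_approximations f"
    using assms by (rule specializable_imp_unimodular_approximations)
  have "\<bar>a\<bar> = 1"
    using specializable_abs_lead_coeff[OF assms] assms(1) by (simp add: a_def)
  then consider "a = 1" | "a = - 1"
    by linarith
  then show ?thesis
  proof cases
    case 1
    with approx unimodular_approximations_monic[of c b] show ?thesis
      by (auto simp: f)
  next
    case 2
    \<comment> \<open>The mirror is monic, so it must be x^2 or x^2 - 1; these are the mirrors of
      -x^2 - 2x - 2 and -x^2 - 2x - 1.\<close>
    have "mirror f = [:b - c, b + 2, 1:]"
      by (simp add: mirror_def f 2 pcompose_pCons one_pCons)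
    with unimodular_approximations_mirror[OF approx]
    have "unimodular_approximations [:b - c, b + 2, 1:]"
      by simp
    then have "b + 2 = 0 \<and> (b - c = 0 \<or> b - c = - 1)"
      by (rule unimodular_approximations_monic)
    then have "b = - 2" "c = - 2 \<or> c = - 1"
      by auto
    with 2 show ?thesis
      by (auto simp: f)
  qed
qed

end
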